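(* There is a universal constant $C>0$ such that the following holds for all $L,\varepsilon,h,\tau>0$, $\sigma^2\ge0$, $n\in\mathbb{N}$. Let $f:\mathbb{R}^d\to\mathbb{R}$ be differentiable, $L$-smooth ($\|\nabla f(x)-\nabla f(y)\|\le L\|x-y\|$ for all $x,y$), convex, and attain its minimum; let $x^*$ be the minimizer closest to $x^0$ and $B=\|x^0-x^*\|$. Let the stochastic gradients satisfy $\mathbb{E}_\xi[\nabla f(x;\xi)]=\nabla f(x)$ and $\mathbb{E}_\xi[\|\nabla f(x;\xi)-\nabla f(x)\|^2]\le\sigma^2$ for all $x\in\mathbb{R}^d$. Then, with a proper choice of the input parameters, the better (in time) of the two methods Minibatch SGD and Hero SGD finds an $\varepsilon$-solution in at most $$C\min\left\{\tau\frac{LB^2}{\varepsilon}+h\left(\frac{LB^2}{\varepsilon}+\frac{\sigma^2B^2}{n\varepsilon^2}\right),\; h\left(\frac{LB^2}{\varepsilon}+\frac{\sigma^2B^2}{\varepsilon^2}\right)\right\}$$ seconds.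
   Context: Minibatch SGD (starting point $x^0$, step size $\eta_g$, $R$ communication rounds, batch size $K$, $n$ workers): for $t=0,\dots,R-1$, each worker $i$ in parallel computes $\nabla f(x^t;\xi^t_{i,j})$ for $j=0,\dots,K-1$ with independent $\xi^t_{i,j}\sim\mathcal D$, and then $x^{t+1}=x^t-\eta_g\sum_{i=1}^n\sum_{j=0}^{K-1}\nabla f(x^t;\xi^t_{i,j})$. Hero SGD (on a single worker, without communication): $x^{t+1}=x^t-\eta\nabla f(x^t;\xi^t)$ with independent $\xi^t\sim\mathcal D$, for $t=0,\dots,R-1$. Time model: computing a single stochastic gradient takes at most $h$ seconds on each worker, workers compute in parallel, and one communication among the workers takes at most $\tau$ seconds. Thus $R$ rounds of Minibatch SGD take at most $\tau R+hKR$ seconds and $R$ steps of Hero SGD take at most $hR$ seconds. An $\varepsilon$-solution is a (possibly random) point $\bar x$, obtained from the iterates of the method (including $x^0$), with $\mathbb{E}[f(\bar x)]-f(x^* )\le\varepsilon$. *)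

theory Defs
  imports "HOL-Probability.Probability"
begin

definition minimizers :: "('a \<Rightarrow> real) \<Rightarrow> 'a set" where
  "minimizers f = {x. \<forall>y. f x \<le> f y}"

text \<open>\<open>g x s\<close> is the stochastic gradient at \<open>x\<close> for the sample \<open>s\<close> and \<open>grad\<close> is the
  gradient of the objective. Joint measurability in \<open>(x, s)\<close> is what makes the iterates of the
  methods random variables.\<close>

definition stochastic_gradient ::
  "'s measure \<Rightarrow> ('a::euclidean_space \<Rightarrow> 's \<Rightarrow> 'a) \<Rightarrow> ('a \<Rightarrow> 'a) \<Rightarrow> real \<Rightarrow> bool" where
  "stochastic_gradient D g grad \<sigma> \<longleftrightarrow>
     prob_space D \<and>
     (\<lambda>(x, s). g x s) \<in> borel_measurable (borel \<Otimes>\<^sub>M D) \<and>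
     (\<forall>x. integrable D (g x) \<and> (LINT s|D. g x s) = grad x) \<and>
     (\<forall>x. integrable D (\<lambda>s. (norm (g x s - grad x))\<^sup>2) \<and>
          (LINT s|D. (norm (g x s - grad x))\<^sup>2) \<le> \<sigma>\<^sup>2)"

definition iid_samples ::
  "'w measure \<Rightarrow> 's measure \<Rightarrow> ('i \<Rightarrow> 'w \<Rightarrow> 's) \<Rightarrow> 'i set \<Rightarrow> bool" where
  "iid_samples M D \<xi> I \<longleftrightarrow>
     prob_space M \<and> prob_space.indep_vars M (\<lambda>_. D) \<xi> I \<and> (\<forall>i\<in>I. distr M D (\<xi> i) = D)"

text \<open>The iterates are defined pathwise: \<open>s (t, i, j)\<close> is the \<open>j\<close>-th sample drawn by worker \<open>i\<close>
  in round \<open>t\<close>. As usual for this form of the method, the sum is not divided by the total batch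
  size \<open>n * K\<close>; that factor is part of the step size.\<close>

primrec minibatch_sgd ::
  "('a::real_vector \<Rightarrow> 's \<Rightarrow> 'a) \<Rightarrow> 'a \<Rightarrow> nat \<Rightarrow> real \<Rightarrow> nat \<Rightarrow> (nat \<times> nat \<times> nat \<Rightarrow> 's) \<Rightarrow> nat \<Rightarrow> 'a"
where
  "minibatch_sgd g x0 n \<eta> K s 0 = x0"
| "minibatch_sgd g x0 n \<eta> K s (Suc t) =
     minibatch_sgd g x0 n \<eta> K s t
       - \<eta> *\<^sub>R (\<Sum>i<n. \<Sum>j<K. g (minibatch_sgd g x0 n \<eta> K s t) (s (t, i, j)))"

primrec hero_sgd ::
  "('a::real_vector \<Rightarrow> 's \<Rightarrow> 'a) \<Rightarrow> 'a \<Rightarrow> real \<Rightarrow> (nat \<Rightarrow> 's) \<Rightarrow> nat \<Rightarrow> 'a"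
where
  "hero_sgd g x0 \<eta> s 0 = x0"
| "hero_sgd g x0 \<eta> s (Suc t) =
     hero_sgd g x0 \<eta> s t - \<eta> *\<^sub>R g (hero_sgd g x0 \<eta> s t) (s t)"

definition minibatch_time :: "real \<Rightarrow> real \<Rightarrow> nat \<Rightarrow> nat \<Rightarrow> real" where
  "minibatch_time h \<tau> K R = \<tau> * real R + h * real K * real R"

definition hero_time :: "real \<Rightarrow> nat \<Rightarrow> real" where
  "hero_time h R = h * real R"

text \<open>The point returned by a method is a convex combination, with deterministic weights, of the
  iterates \<open>X 0, \<dots>, X R\<close>; this covers a single iterate (in particular the last one, or
  \<open>x\<^sup>0\<close> when \<open>R = 0\<close>) and all averages. An arbitrary function of the iterates must not be
  allowed, since a constant function could return the minimizer outright.\<close>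

definition convex_weights :: "nat \<Rightarrow> (nat \<Rightarrow> real) \<Rightarrow> bool" where
  "convex_weights R w \<longleftrightarrow> (\<forall>t\<le>R. 0 \<le> w t) \<and> (\<Sum>t\<le>R. w t) = 1"

definition weighted_point :: "nat \<Rightarrow> (nat \<Rightarrow> real) \<Rightarrow> (nat \<Rightarrow> 'a::real_vector) \<Rightarrow> 'a" where
  "weighted_point R w X = (\<Sum>t\<le>R. w t *\<^sub>R X t)"

definition eps_solution ::
  "'w measure \<Rightarrow> ('a \<Rightarrow> real) \<Rightarrow> 'a \<Rightarrow> real \<Rightarrow> ('w \<Rightarrow> 'a) \<Rightarrow> bool" where
  "eps_solution M f xs \<epsilon> X \<longleftrightarrow>
     integrable M (\<lambda>\<omega>. f (X \<omega>)) \<and> (LINT \<omega>|M. f (X \<omega>)) - f xs \<le> \<epsilon>"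

definition minibatch_finds_within ::
  "'w measure \<Rightarrow> (nat \<times> nat \<times> nat \<Rightarrow> 'w \<Rightarrow> 's) \<Rightarrow> ('a::euclidean_space \<Rightarrow> real) \<Rightarrow>
   ('a \<Rightarrow> 's \<Rightarrow> 'a) \<Rightarrow> 'a \<Rightarrow> 'a \<Rightarrow> nat \<Rightarrow> real \<Rightarrow> real \<Rightarrow> real \<Rightarrow> real \<Rightarrow> bool" where
  "minibatch_finds_within M \<xi> f g x0 xs n \<epsilon> h \<tau> T \<longleftrightarrow>
     (\<exists>\<eta> K R w. 0 < \<eta> \<and> 1 \<le> K \<and> convex_weights R w \<and> minibatch_time h \<tau> K R \<le> T \<and>
        eps_solution M f xs \<epsilon>
          (\<lambda>\<omega>. weighted_point R w (minibatch_sgd g x0 n \<eta> K (\<lambda>k. \<xi> k \<omega>))))"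

definition hero_finds_within ::
  "'w measure \<Rightarrow> (nat \<Rightarrow> 'w \<Rightarrow> 's) \<Rightarrow> ('a::euclidean_space \<Rightarrow> real) \<Rightarrow>
   ('a \<Rightarrow> 's \<Rightarrow> 'a) \<Rightarrow> 'a \<Rightarrow> 'a \<Rightarrow> real \<Rightarrow> real \<Rightarrow> real \<Rightarrow> bool" where
  "hero_finds_within M \<zeta> f g x0 xs \<epsilon> h T \<longleftrightarrow>
     (\<exists>\<eta> R w. 0 < \<eta> \<and> convex_weights R w \<and> hero_time h R \<le> T \<and>
        eps_solution M f xs \<epsilon>
          (\<lambda>\<omega>. weighted_point R w (hero_sgd g x0 \<eta> (\<lambda>k. \<zeta> k \<omega>))))"

text \<open>The dimension and the sample spaces are represented by types, and HOL cannot quantify over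
  types under an existential quantifier: in a polymorphic theorem stating that some constant
  exists, the constant could depend on the dimension. A closed numeral is universal in the
  intended sense; its value is not optimised.\<close>

definition universal_constant :: real where
  "universal_constant = 100"

end

theory Submission
  imports Defs
begin

text \<open>Both methods are instances of one recursion: in round \<open>t\<close> a fresh batch \<open>J t\<close> of \<open>m\<close>
  sample indices is consumed and \<open>x\<close> moves by \<open>- \<eta>\<close> times the sum of the \<open>m\<close> stochastic gradients.
  With \<open>\<gamma> = \<eta> * m\<close> this is a gradient step of length \<open>\<gamma>\<close> perturbed by \<open>m\<close> independent centred
  errors of variance at most \<open>\<sigma>\<^sup>2\<close> each, scaled by \<open>\<eta>\<close>. If \<open>\<gamma> \<le> 1 / (2 * L)\<close>, an exact step lowers
  the squared distance to the minimizer by at least \<open>\<gamma>\<close> times the gap \<open>f x - f xs\<close>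
  (\<open>gradient_step\<close>: convexity gives a decrease of twice that amount, and smoothness bounds the
  quadratic term by half of it). The errors have mean zero given the past, so they add at most
  \<open>m * \<eta>\<^sup>2 * \<sigma>\<^sup>2\<close> in expectation (\<open>nn_integral_partial_round_le\<close>). Telescoping over \<open>R\<close> rounds and
  applying Jensen's inequality to the average of the first \<open>R\<close> iterates bounds its expected gap by
  \<open>B\<^sup>2 / (\<gamma> * R) + \<eta> * \<sigma>\<^sup>2\<close> (\<open>eps_solution_uniform_average\<close>).

  It remains to make both summands at most \<open>\<epsilon> / 2\<close>. Minibatch SGD takes \<open>\<gamma> = 1 / (2 * L)\<close>, so
  about \<open>4 * L * B\<^sup>2 / \<epsilon>\<close> rounds suffice, and uses the batch size
  \<open>K\<close> of order \<open>1 + \<sigma>\<^sup>2 / (L * n * \<epsilon>)\<close> to suppress the noise. Hero SGD has \<open>m = 1\<close> and instead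
  shrinks the step to \<open>\<gamma> = 1 / (2 * (L + \<sigma>\<^sup>2 / \<epsilon>))\<close>. Rounding the number of rounds up is harmless
  as long as \<open>L * B\<^sup>2 / \<epsilon>\<close> is bounded below; when it is at most \<open>2\<close>, smoothness makes \<open>x0\<close> itself an
  \<open>\<epsilon>\<close>-solution, found in no time at all.\<close>

section \<open>Smooth convex functions\<close>

lemma continuous_on_GDERIV:
  assumes "\<And>x. GDERIV f x :> grad x"
  shows "continuous_on UNIV f"
  using assms by (meson gderiv_def has_derivative_continuous continuous_at_imp_continuous_on)

locale smooth_convex_minimum =
  fixes f :: "'a::euclidean_space \<Rightarrow> real" and grad :: "'a \<Rightarrow> 'a" and L :: real and xs :: 'a
  assumes L_pos: "0 < L"
    and gradient: "GDERIV f x :> grad x"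
    and smooth: "norm (grad x - grad y) \<le> L * norm (x - y)"
    and convex: "convex_on UNIV f"
    and minimum: "f xs \<le> f x"
begin

lemma continuous_objective: "continuous_on UNIV f"
  using gradient by (rule continuous_on_GDERIV)

lemma continuous_gradient: "continuous_on UNIV grad"
proof -
  have "L-lipschitz_on UNIV grad"
    using L_pos smooth by (intro lipschitz_onI) (auto simp: dist_norm)
  then show ?thesis
    by (rule lipschitz_on_continuous_on)
qed

lemma derivative_along_line:
  "((\<lambda>t. f (x + t *\<^sub>R d)) has_real_derivative grad (x + t *\<^sub>R d) \<bullet> d) (at t)"
proof -
  have "((\<lambda>t. x + t *\<^sub>R d) has_derivative (\<lambda>h. h *\<^sub>R d)) (at t)"
    by (auto intro!: derivative_eq_intros)
  moreover have "(f has_derivative (\<lambda>h. h \<bullet> grad (x + t *\<^sub>R d))) (at (x + t *\<^sub>R d))"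
    using gradient[of "x + t *\<^sub>R d"] by (simp add: gderiv_def)
  ultimately have "((\<lambda>t. f (x + t *\<^sub>R d)) has_derivative
      (\<lambda>h. (h *\<^sub>R d) \<bullet> grad (x + t *\<^sub>R d))) (at t)"
    by (rule has_derivative_compose)
  then show ?thesis
    by (simp add: has_field_derivative_def inner_commute mult.commute[of _ "d \<bullet> _"])
qed

text \<open>Restricting \<open>f\<close> to the line through \<open>x\<close> and \<open>y\<close> reduces this to convex functions of one
  real variable, which lie above their tangents.\<close>
lemma gradient_inequality: "f x + grad x \<bullet> (y - x) \<le> f y"
proof -
  define \<phi> where "\<phi> t = f (x + t *\<^sub>R (y - x))" for t
  have "convex_on UNIV \<phi>"
  proof (rule convex_onI)
    fix t u v :: real
    assume "0 < t" "t < 1"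
    have "x + ((1 - t) * u + t * v) *\<^sub>R (y - x)
        = (1 - t) *\<^sub>R (x + u *\<^sub>R (y - x)) + t *\<^sub>R (x + v *\<^sub>R (y - x))"
      by (simp add: algebra_simps)
    then show "\<phi> ((1 - t) *\<^sub>R u + t *\<^sub>R v) \<le> (1 - t) * \<phi> u + t * \<phi> v"
      unfolding \<phi>_def using convex_onD[OF convex, of t] \<open>0 < t\<close> \<open>t < 1\<close> by simp
  qed auto
  moreover have "(\<phi> has_real_derivative grad x \<bullet> (y - x)) (at 0 within UNIV)"
    unfolding \<phi>_def using derivative_along_line[of x "y - x" 0] by simp
  ultimately have "grad x \<bullet> (y - x) * (1 - 0) \<le> \<phi> 1 - \<phi> 0"
    by (intro convex_on_imp_above_tangent) auto
  then show ?thesis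
    by (simp add: \<phi>_def)
qed

text \<open>Along the segment from \<open>x\<close> to \<open>y\<close>, the difference of the two sides is monotone, because the
  gradient changes at most at rate \<open>L\<close>.\<close>
lemma descent_inequality: "f y \<le> f x + grad x \<bullet> (y - x) + L / 2 * (norm (y - x))\<^sup>2"
proof -
  define d where "d = y - x"
  define \<psi> where "\<psi> t = f (x + t *\<^sub>R d) - t * (grad x \<bullet> d) - L / 2 * t\<^sup>2 * (norm d)\<^sup>2" for t
  have "\<psi> 1 \<le> \<psi> 0"
  proof (rule DERIV_nonpos_imp_nonincreasing[where f = \<psi> and a = 0 and b = 1])
    fix t :: real
    assume t: "0 \<le> t" "t \<le> 1"
    have "(\<psi> has_real_derivative
        (grad (x + t *\<^sub>R d) \<bullet> d - grad x \<bullet> d - L * t * (norm d)\<^sup>2)) (at t)"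
      unfolding \<psi>_def by (rule derivative_eq_intros derivative_along_line refl | simp)+
    moreover have "grad (x + t *\<^sub>R d) \<bullet> d - grad x \<bullet> d - L * t * (norm d)\<^sup>2 \<le> 0"
    proof -
      have "(grad (x + t *\<^sub>R d) - grad x) \<bullet> d \<le> norm (grad (x + t *\<^sub>R d) - grad x) * norm d"
        by (rule norm_cauchy_schwarz)
      also have "\<dots> \<le> L * norm (t *\<^sub>R d) * norm d"
        using smooth[of "x + t *\<^sub>R d" x] by (intro mult_right_mono) auto
      also have "\<dots> = L * t * (norm d)\<^sup>2"
        using t by (simp add: power2_eq_square)
      finally show ?thesis
        by (simp add: inner_diff_left)
    qed
    ultimately show "\<exists>y. DERIV \<psi> t :> y \<and> y \<le> 0"
      by blast
  qed simp
  then show ?thesis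
    by (simp add: \<psi>_def d_def)
qed

text \<open>A gradient step of length \<open>1 / L\<close> decreases \<open>f\<close> by at least \<open>\<parallel>grad x\<parallel>\<^sup>2 / (2 * L)\<close>, and it
  cannot go below the minimum. In particular the gradient vanishes at \<open>xs\<close>.\<close>
lemma norm_gradient_le: "(norm (grad x))\<^sup>2 \<le> 2 * L * (f x - f xs)"
proof -
  have "f xs \<le> f (x - (1 / L) *\<^sub>R grad x)"
    by (rule minimum)
  also have "\<dots> \<le> f x - 1 / L * (norm (grad x))\<^sup>2 + L / 2 * (norm (grad x) / L)\<^sup>2"
    using descent_inequality[of "x - (1 / L) *\<^sub>R grad x" x] L_pos
    by (simp add: power2_norm_eq_inner)
  also have "\<dots> = f x - (norm (grad x))\<^sup>2 / (2 * L)"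
    using L_pos by (simp add: power_divide) (simp add: field_simps power2_eq_square)
  finally show ?thesis
    using L_pos by (simp add: field_simps)
qed

lemma suboptimality_le: "f x - f xs \<le> L / 2 * (norm (x - xs))\<^sup>2"
  using descent_inequality[of x xs] norm_gradient_le[of xs] by simp

text \<open>Expanding the square, the linear term contributes at most \<open>- 2 * \<gamma> * (f x - f xs)\<close> and the
  quadratic one at most \<open>2 * L * \<gamma>\<^sup>2 * (f x - f xs)\<close>; the restriction on \<open>\<gamma>\<close> makes the latter eat
  up at most half of the former.\<close>
lemma gradient_step:
  assumes "0 \<le> \<gamma>" "\<gamma> * (2 * L) \<le> 1"
  shows "(norm (x - xs - \<gamma> *\<^sub>R grad x))\<^sup>2 + \<gamma> * (f x - f xs) \<le> (norm (x - xs))\<^sup>2"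
proof -
  have "(norm (x - xs - \<gamma> *\<^sub>R grad x))\<^sup>2
      = (norm (x - xs))\<^sup>2 + 2 * \<gamma> * (grad x \<bullet> (xs - x)) + \<gamma>\<^sup>2 * (norm (grad x))\<^sup>2"
    unfolding power2_norm_eq_inner
    by (simp add: inner_diff_left inner_diff_right inner_commute power2_eq_square algebra_simps)
  also have "\<dots> \<le> (norm (x - xs))\<^sup>2 + 2 * \<gamma> * (f xs - f x) + \<gamma>\<^sup>2 * (2 * L * (f x - f xs))"
    using gradient_inequality[of x xs] norm_gradient_le[of x] assms
    by (intro add_mono mult_left_mono) auto
  also have "\<gamma>\<^sup>2 * (2 * L * (f x - f xs)) = \<gamma> * (\<gamma> * (2 * L)) * (f x - f xs)"
    by (simp add: power2_eq_square)
  also have "\<dots> \<le> \<gamma> * 1 * (f x - f xs)"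
    using assms minimum[of x] by (intro mult_right_mono mult_left_mono) auto
  finally show ?thesis
    by (simp add: algebra_simps)
qed

end

section \<open>Independent noise\<close>

text \<open>Any function of the samples in \<open>U\<close> is independent of a sample outside \<open>U\<close>, so that sample can
  be integrated out first, with the others frozen. Working with nonnegative integrands throughout
  (Tonelli rather than Fubini) spares all integrability proofs for the iterates: finiteness of
  their second moments comes out of the final estimate.\<close>
lemma nn_integral_indep_le:
  assumes "iid_samples M D \<xi> I" "U \<subseteq> I" "a \<in> I" "a \<notin> U"
    and \<phi> [measurable]: "\<phi> \<in> borel_measurable (PiM U (\<lambda>_. D) \<Otimes>\<^sub>M D)"
    and \<psi> [measurable]: "\<psi> \<in> borel_measurable (PiM U (\<lambda>_. D))"
    and bound: "\<And>y. y \<in> space (PiM U (\<lambda>_. D)) \<Longrightarrow> (\<integral>\<^sup>+ s. \<phi> (y, s) \<partial>D) \<le> \<psi> y"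
  shows "(\<integral>\<^sup>+ \<omega>. \<phi> (restrict (\<lambda>k. \<xi> k \<omega>) U, \<xi> a \<omega>) \<partial>M)
    \<le> (\<integral>\<^sup>+ \<omega>. \<psi> (restrict (\<lambda>k. \<xi> k \<omega>) U) \<partial>M)"
proof -
  interpret prob_space M
    using assms(1) by (simp add: iid_samples_def)
  let ?P = "\<lambda>U. PiM U (\<lambda>_. D)"
  define Y where "Y \<omega> = restrict (\<lambda>k. \<xi> k \<omega>) U" for \<omega>
  define Z where "Z \<omega> = restrict (\<lambda>k. \<xi> k \<omega>) {a}" for \<omega>
  have indep: "indep_var (?P U) Y (?P {a}) Z"
    unfolding Y_def[abs_def] Z_def[abs_def]
    using assms by (intro indep_var_restrict[where I = I]) (auto simp: iid_samples_def)
  have Y [measurable]: "Y \<in> measurable M (?P U)" and Z [measurable]: "Z \<in> measurable M (?P {a})"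
    using indep by (auto dest: indep_var_rv1 indep_var_rv2)
  have a [measurable]: "\<xi> a \<in> measurable M D"
    using assms(1,3) by (auto simp: iid_samples_def indep_vars_def2)
  have eval [measurable]: "(\<lambda>z. z a) \<in> measurable (?P {a}) D"
    by (rule measurable_component_singleton) simp
  interpret Z: prob_space "distr M (?P {a}) Z"
    by (rule prob_space_distr) measurable
  have lift [measurable]: "(\<lambda>p. \<phi> (fst p, snd p a)) \<in> borel_measurable (?P U \<Otimes>\<^sub>M ?P {a})"
    by measurable
  have joint: "distr M (?P U \<Otimes>\<^sub>M ?P {a}) (\<lambda>\<omega>. (Y \<omega>, Z \<omega>))
      = distr M (?P U) Y \<Otimes>\<^sub>M distr M (?P {a}) Z"
    using indep by (simp add: indep_var_distribution_eq)
  have "(\<integral>\<^sup>+ \<omega>. \<phi> (Y \<omega>, \<xi> a \<omega>) \<partial>M) = (\<integral>\<^sup>+ \<omega>. \<phi> (Y \<omega>, Z \<omega> a) \<partial>M)"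
    by (simp add: Z_def)
  also have "\<dots> = (\<integral>\<^sup>+ p. \<phi> (fst p, snd p a) \<partial>(distr M (?P U) Y \<Otimes>\<^sub>M distr M (?P {a}) Z))"
    by (simp add: joint[symmetric] nn_integral_distr)
  also have "\<dots> = (\<integral>\<^sup>+ y. \<integral>\<^sup>+ z. \<phi> (y, z a) \<partial>distr M (?P {a}) Z \<partial>distr M (?P U) Y)"
    by (subst Z.nn_integral_fst[symmetric])
      (simp_all cong: measurable_cong_sets sets_pair_measure_cong)
  also have "\<dots> \<le> (\<integral>\<^sup>+ y. \<psi> y \<partial>distr M (?P U) Y)"
  proof (rule nn_integral_mono)
    fix y
    assume "y \<in> space (distr M (?P U) Y)"
    then have y: "y \<in> space (?P U)"
      by simp
    have \<phi>_y [measurable]: "(\<lambda>s. \<phi> (y, s)) \<in> borel_measurable D"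
      using measurable_compose[OF measurable_Pair1'[OF y] \<phi>] .
    have "(\<integral>\<^sup>+ z. \<phi> (y, z a) \<partial>distr M (?P {a}) Z) = (\<integral>\<^sup>+ \<omega>. \<phi> (y, \<xi> a \<omega>) \<partial>M)"
      by (subst nn_integral_distr) (auto simp: Z_def intro: measurable_compose[OF eval \<phi>_y])
    also have "\<dots> = (\<integral>\<^sup>+ s. \<phi> (y, s) \<partial>distr M D (\<xi> a))"
      by (simp add: nn_integral_distr)
    also have "\<dots> \<le> \<psi> y"
      using assms(1,3) bound[OF y] by (simp add: iid_samples_def)
    finally show "(\<integral>\<^sup>+ z. \<phi> (y, z a) \<partial>distr M (?P {a}) Z) \<le> \<psi> y" .
  qed
  also have "\<dots> = (\<integral>\<^sup>+ \<omega>. \<psi> (Y \<omega>) \<partial>M)"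
    by (simp add: nn_integral_distr)
  finally show ?thesis
    by (simp add: Y_def)
qed

text \<open>The cross term vanishes because the stochastic gradient is unbiased.\<close>
lemma nn_integral_noise_le:
  assumes "stochastic_gradient D g grad \<sigma>"
  shows "(\<integral>\<^sup>+ s. ennreal ((norm (z - \<eta> *\<^sub>R (g x s - grad x)))\<^sup>2) \<partial>D)
    \<le> ennreal ((norm z)\<^sup>2) + ennreal (\<eta>\<^sup>2 * \<sigma>\<^sup>2)"
proof -
  interpret D: prob_space D
    using assms by (simp add: stochastic_gradient_def)
  define e where "e s = g x s - grad x" for s
  have e: "integrable D e" "integrable D (\<lambda>s. (norm (e s))\<^sup>2)"
    and mean: "(LINT s|D. e s) = 0" and var: "(LINT s|D. (norm (e s))\<^sup>2) \<le> \<sigma>\<^sup>2"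
    using assms by (auto simp: e_def[abs_def] stochastic_gradient_def D.prob_space)
  have expand: "(norm (z - \<eta> *\<^sub>R e s))\<^sup>2
      = (norm z)\<^sup>2 - 2 * \<eta> * (z \<bullet> e s) + \<eta>\<^sup>2 * (norm (e s))\<^sup>2" for s
    unfolding power2_norm_eq_inner
    by (simp add: inner_diff_left inner_diff_right inner_commute power2_eq_square algebra_simps)
  have "integrable D (\<lambda>s. (norm (z - \<eta> *\<^sub>R e s))\<^sup>2)"
    unfolding expand using e by auto
  then have "(\<integral>\<^sup>+ s. ennreal ((norm (z - \<eta> *\<^sub>R e s))\<^sup>2) \<partial>D)
      = ennreal (LINT s|D. (norm (z - \<eta> *\<^sub>R e s))\<^sup>2)"
    by (intro nn_integral_eq_integral) auto
  also have "(LINT s|D. (norm (z - \<eta> *\<^sub>R e s))\<^sup>2)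
      = (norm z)\<^sup>2 + \<eta>\<^sup>2 * (LINT s|D. (norm (e s))\<^sup>2)"
    unfolding expand using e mean by (simp add: D.prob_space)
  also have "ennreal \<dots> \<le> ennreal ((norm z)\<^sup>2 + \<eta>\<^sup>2 * \<sigma>\<^sup>2)"
    using var by (intro ennreal_leI add_left_mono mult_left_mono) auto
  finally show ?thesis
    by (simp add: e_def)
qed

section \<open>Stochastic gradient descent with batches\<close>

text \<open>The common form of the two methods, with an arbitrary index set for the samples.\<close>
primrec batch_sgd ::
  "('a::real_vector \<Rightarrow> 's \<Rightarrow> 'a) \<Rightarrow> 'a \<Rightarrow> real \<Rightarrow> (nat \<Rightarrow> 'i set) \<Rightarrow> ('i \<Rightarrow> 's) \<Rightarrow> nat \<Rightarrow> 'a"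
where
  "batch_sgd g x0 \<eta> J s 0 = x0"
| "batch_sgd g x0 \<eta> J s (Suc t) = batch_sgd g x0 \<eta> J s t
     - \<eta> *\<^sub>R (\<Sum>k\<in>J t. g (batch_sgd g x0 \<eta> J s t) (s k))"

lemma minibatch_sgd_eq_batch_sgd:
  "minibatch_sgd g x0 n \<eta> K s = batch_sgd g x0 \<eta> (\<lambda>t. Pair t ` ({..<n} \<times> {..<K})) s"
proof
  fix t
  show "minibatch_sgd g x0 n \<eta> K s t = batch_sgd g x0 \<eta> (\<lambda>t. Pair t ` ({..<n} \<times> {..<K})) s t"
    by (induction t) (simp_all add: sum.reindex inj_on_def sum.cartesian_product split_def)
qed

lemma hero_sgd_eq_batch_sgd: "hero_sgd g x0 \<eta> s = batch_sgd g x0 \<eta> (\<lambda>t. {t}) s"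
proof
  fix t
  show "hero_sgd g x0 \<eta> s t = batch_sgd g x0 \<eta> (\<lambda>t. {t}) s t"
    by (induction t) simp_all
qed

lemma batch_sgd_cong:
  assumes "\<And>r k. r < t \<Longrightarrow> k \<in> J r \<Longrightarrow> s k = s' k"
  shows "batch_sgd g x0 \<eta> J s t = batch_sgd g x0 \<eta> J s' t"
  using assms
proof (induction t)
  case (Suc t)
  have "batch_sgd g x0 \<eta> J s t = batch_sgd g x0 \<eta> J s' t"
    using Suc.prems less_SucI by (intro Suc.IH) blast
  moreover have "s k = s' k" if "k \<in> J t" for k
    using Suc.prems[of t] that by simp
  ultimately show ?case
    by simp
qed simp

lemma measurable_gradient_sample:
  assumes "stochastic_gradient D g grad \<sigma>" and "X \<in> borel_measurable N" and "Y \<in> measurable N D"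
  shows "(\<lambda>\<omega>. g (X \<omega>) (Y \<omega>)) \<in> borel_measurable N"
proof -
  have "(\<lambda>(x, s). g x s) \<in> borel_measurable (borel \<Otimes>\<^sub>M D)"
    using assms(1) by (simp add: stochastic_gradient_def)
  from measurable_compose[OF measurable_Pair[OF assms(2,3)] this] show ?thesis
    by simp
qed

lemma measurable_batch_sgd:
  assumes "stochastic_gradient D g grad \<sigma>" and "\<And>r k. r < t \<Longrightarrow> k \<in> J r \<Longrightarrow> Y k \<in> measurable N D"
  shows "(\<lambda>\<omega>. batch_sgd g x0 \<eta> J (\<lambda>k. Y k \<omega>) t) \<in> borel_measurable N"
  using assms(2)
proof (induction t)
  case (Suc t)
  have X: "(\<lambda>\<omega>. batch_sgd g x0 \<eta> J (\<lambda>k. Y k \<omega>) t) \<in> borel_measurable N"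
    using Suc.prems less_SucI by (intro Suc.IH) blast
  have "(\<lambda>\<omega>. g (batch_sgd g x0 \<eta> J (\<lambda>k. Y k \<omega>) t) (Y k \<omega>)) \<in> borel_measurable N"
    if "k \<in> J t" for k
    using Suc.prems[of t k] that by (intro measurable_gradient_sample[OF assms(1) X]) simp
  then show ?case
    using X by simp
qed simp

locale batch_sgd_setting = smooth_convex_minimum f grad L xs
  for f :: "'a::euclidean_space \<Rightarrow> real" and grad L xs +
  fixes D :: "'s measure" and g :: "'a \<Rightarrow> 's \<Rightarrow> 'a" and \<sigma> :: real
    and M :: "'w measure" and \<xi> :: "'i \<Rightarrow> 'w \<Rightarrow> 's" and I :: "'i set"
    and J :: "nat \<Rightarrow> 'i set" and m :: nat and x0 :: 'a and \<eta> :: real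
  assumes stochastic: "stochastic_gradient D g grad \<sigma>"
    and samples: "iid_samples M D \<xi> I"
    and batches: "J t \<subseteq> I" "finite (J t)" "card (J t) = m"
    and disjoint_batches: "disjoint_family J"
    and step_size: "0 < \<eta>" "1 \<le> m" "\<eta> * real m * (2 * L) \<le> 1"
begin

sublocale prob_space M
  using samples by (simp add: iid_samples_def)

abbreviation "iterate s t \<equiv> batch_sgd g x0 \<eta> J s t"

abbreviation "X t \<omega> \<equiv> iterate (\<lambda>k. \<xi> k \<omega>) t"

lemma measurable_sample: "k \<in> I \<Longrightarrow> \<xi> k \<in> measurable M D"
  using samples by (auto simp: iid_samples_def indep_vars_def2)

lemma measurable_iterate [measurable]: "X t \<in> borel_measurable M"
  using batches(1) by (intro measurable_batch_sgd[OF stochastic] measurable_sample) auto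

lemma measurable_gradient [measurable]: "grad \<in> borel_measurable borel"
  by (intro borel_measurable_continuous_onI continuous_gradient)

lemma measurable_objective [measurable]: "f \<in> borel_measurable borel"
  by (intro borel_measurable_continuous_onI continuous_objective)

text \<open>Adding the errors of a round one at a time avoids handling their pairwise correlations.
  This is the displacement from \<open>xs\<close> after an exact gradient step from iterate \<open>t\<close> with only the
  errors of the samples in \<open>A\<close> added; for \<open>A = J t\<close> the exact gradients cancel and the next
  iterate appears.\<close>
definition partial_round :: "'i set \<Rightarrow> nat \<Rightarrow> ('i \<Rightarrow> 's) \<Rightarrow> 'a" where
  "partial_round A t s =
     iterate s t - xs - (\<eta> * real m) *\<^sub>R grad (iterate s t)
       - \<eta> *\<^sub>R (\<Sum>k\<in>A. g (iterate s t) (s k) - grad (iterate s t))"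

lemma partial_round_full: "partial_round (J t) t s = iterate s (Suc t) - xs"
  using batches(3)
  by (simp add: partial_round_def sum_subtractf sum_constant_scaleR algebra_simps)

lemma partial_round_empty:
  "partial_round {} t s = iterate s t - xs - (\<eta> * real m) *\<^sub>R grad (iterate s t)"
  by (simp add: partial_round_def)

lemma partial_round_cong:
  assumes "\<And>r k. r < t \<Longrightarrow> k \<in> J r \<Longrightarrow> s k = s' k" "\<And>k. k \<in> A \<Longrightarrow> s k = s' k"
  shows "partial_round A t s = partial_round A t s'"
proof -
  have "iterate s t = iterate s' t"
    using assms(1) by (rule batch_sgd_cong)
  then show ?thesis
    using assms(2) by (simp add: partial_round_def cong: sum.cong)
qed

lemma measurable_partial_round:
  assumes "\<And>r k. r < t \<Longrightarrow> k \<in> J r \<Longrightarrow> Y k \<in> measurable N D" "\<And>k. k \<in> A \<Longrightarrow> Y k \<in> measurable N D"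
  shows "(\<lambda>\<omega>. partial_round A t (\<lambda>k. Y k \<omega>)) \<in> borel_measurable N"
proof -
  have [measurable]: "(\<lambda>\<omega>. iterate (\<lambda>k. Y k \<omega>) t) \<in> borel_measurable N"
    using assms(1) by (rule measurable_batch_sgd[OF stochastic])
  have [measurable]: "(\<lambda>\<omega>. g (iterate (\<lambda>k. Y k \<omega>) t) (Y k \<omega>)) \<in> borel_measurable N"
    if "k \<in> A" for k
    using assms(2)[OF that] by (intro measurable_gradient_sample[OF stochastic]) auto
  show ?thesis
    unfolding partial_round_def by measurable
qed

text \<open>Iterate \<open>t\<close> and the errors already added depend only on the samples of earlier rounds and of
  \<open>A\<close>. The batches being disjoint, sample \<open>a\<close> is independent of these, so its error is centred
  given the current displacement.\<close>
lemma nn_integral_partial_round_insert_le: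
  assumes "A \<subseteq> J t" "a \<in> J t" "a \<notin> A"
  shows "(\<integral>\<^sup>+ \<omega>. ennreal ((norm (partial_round (insert a A) t (\<lambda>k. \<xi> k \<omega>)))\<^sup>2) \<partial>M)
    \<le> (\<integral>\<^sup>+ \<omega>. ennreal ((norm (partial_round A t (\<lambda>k. \<xi> k \<omega>)))\<^sup>2) \<partial>M) + ennreal (\<eta>\<^sup>2 * \<sigma>\<^sup>2)"
proof -
  \<comment> \<open>the samples that determine the current displacement\<close>
  define U where "U = (\<Union>r<t. J r) \<union> A"
  let ?P = "PiM U (\<lambda>_. D)"
  define \<phi> where "\<phi> = (\<lambda>(s, u). ennreal ((norm (partial_round A t s
    - \<eta> *\<^sub>R (g (iterate s t) u - grad (iterate s t))))\<^sup>2))"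
  define \<psi> where "\<psi> s = ennreal ((norm (partial_round A t s))\<^sup>2) + ennreal (\<eta>\<^sup>2 * \<sigma>\<^sup>2)" for s
  have "a \<notin> J r" if "r < t" for r
    using assms(2) that disjoint_family_onD[OF disjoint_batches, of r t] by auto
  then have U: "U \<subseteq> I" "a \<in> I" "a \<notin> U"
    using assms batches(1) by (auto simp: U_def)
  have "finite A"
    using assms(1) batches(2) by (rule finite_subset)
  then have insert: "partial_round (insert a A) t s
      = partial_round A t s - \<eta> *\<^sub>R (g (iterate s t) (s a) - grad (iterate s t))" for s
    using assms(3) by (simp add: partial_round_def algebra_simps)
  have component: "(\<lambda>s. s k) \<in> measurable ?P D" if "k \<in> U" for k
    using that by (rule measurable_component_singleton)
  have [measurable]: "(\<lambda>s. iterate s t) \<in> borel_measurable ?P"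
    by (intro measurable_batch_sgd[OF stochastic] component) (auto simp: U_def)
  have [measurable]: "partial_round A t \<in> borel_measurable ?P"
    by (intro measurable_partial_round component) (auto simp: U_def)
  have [measurable]: "(\<lambda>p. g (iterate (fst p) t) (snd p)) \<in> borel_measurable (?P \<Otimes>\<^sub>M D)"
    by (intro measurable_gradient_sample[OF stochastic]) measurable
  have same: "iterate (restrict s U) t = iterate s t"
    "partial_round A t (restrict s U) = partial_round A t s" for s
    by (rule batch_sgd_cong partial_round_cong; force simp: U_def)+
  have [measurable]: "(\<lambda>\<omega>. partial_round A t (\<lambda>k. \<xi> k \<omega>)) \<in> borel_measurable M"
    using assms(1) batches(1) by (intro measurable_partial_round measurable_sample) blast+
  have "(\<integral>\<^sup>+ \<omega>. ennreal ((norm (partial_round (insert a A) t (\<lambda>k. \<xi> k \<omega>)))\<^sup>2) \<partial>M)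
      = (\<integral>\<^sup>+ \<omega>. \<phi> (restrict (\<lambda>k. \<xi> k \<omega>) U, \<xi> a \<omega>) \<partial>M)"
    by (simp add: \<phi>_def insert same)
  also have "\<dots> \<le> (\<integral>\<^sup>+ \<omega>. \<psi> (restrict (\<lambda>k. \<xi> k \<omega>) U) \<partial>M)"
  proof (rule nn_integral_indep_le[OF samples U])
    show "\<phi> \<in> borel_measurable (?P \<Otimes>\<^sub>M D)"
      unfolding \<phi>_def split_def by measurable
    show "\<psi> \<in> borel_measurable ?P"
      unfolding \<psi>_def by measurable
    show "(\<integral>\<^sup>+ u. \<phi> (s, u) \<partial>D) \<le> \<psi> s" for s
      by (simp only: \<phi>_def \<psi>_def prod.case nn_integral_noise_le[OF stochastic])
  qed
  also have "\<dots> = (\<integral>\<^sup>+ \<omega>. ennreal ((norm (partial_round A t (\<lambda>k. \<xi> k \<omega>)))\<^sup>2) \<partial>M)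
      + ennreal (\<eta>\<^sup>2 * \<sigma>\<^sup>2)"
    by (simp add: \<psi>_def same nn_integral_add emeasure_space_1)
  finally show ?thesis .
qed

lemma nn_integral_partial_round_le:
  assumes "A \<subseteq> J t"
  shows "(\<integral>\<^sup>+ \<omega>. ennreal ((norm (partial_round A t (\<lambda>k. \<xi> k \<omega>)))\<^sup>2) \<partial>M)
    \<le> (\<integral>\<^sup>+ \<omega>. ennreal ((norm (partial_round {} t (\<lambda>k. \<xi> k \<omega>)))\<^sup>2) \<partial>M)
      + ennreal (real (card A) * (\<eta>\<^sup>2 * \<sigma>\<^sup>2))"
proof -
  have "finite A"
    using assms batches(2) by (rule finite_subset)
  then show ?thesis
    using assms
  proof (induction A rule: finite_induct)
    case (insert a A)
    let ?E = "\<lambda>A. \<integral>\<^sup>+ \<omega>. ennreal ((norm (partial_round A t (\<lambda>k. \<xi> k \<omega>)))\<^sup>2) \<partial>M"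
    have "?E (insert a A) \<le> ?E A + ennreal (\<eta>\<^sup>2 * \<sigma>\<^sup>2)"
      using insert by (intro nn_integral_partial_round_insert_le) auto
    also have "\<dots> \<le> ?E {} + ennreal (real (card A) * (\<eta>\<^sup>2 * \<sigma>\<^sup>2)) + ennreal (\<eta>\<^sup>2 * \<sigma>\<^sup>2)"
      using insert by (intro add_right_mono) auto
    also have "\<dots> = ?E {} + ennreal (real (card (insert a A)) * (\<eta>\<^sup>2 * \<sigma>\<^sup>2))"
      using insert by (simp add: add.assoc ennreal_plus[symmetric] distrib_right
          add.commute del: ennreal_plus)
    finally show ?case .
  qed simp
qed

abbreviation "expected_sq_dist t \<equiv> \<integral>\<^sup>+ \<omega>. ennreal ((norm (X t \<omega> - xs))\<^sup>2) \<partial>M"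

abbreviation "expected_gap t \<equiv> \<integral>\<^sup>+ \<omega>. ennreal (f (X t \<omega>) - f xs) \<partial>M"

lemma expected_sq_dist_step:
  "expected_sq_dist (Suc t) + ennreal (\<eta> * real m) * expected_gap t
    \<le> expected_sq_dist t + ennreal (real m * (\<eta>\<^sup>2 * \<sigma>\<^sup>2))"
proof -
  let ?\<gamma> = "\<eta> * real m"
  let ?Z = "\<lambda>\<omega>. X t \<omega> - xs - ?\<gamma> *\<^sub>R grad (X t \<omega>)"
  have "expected_sq_dist (Suc t)
      \<le> (\<integral>\<^sup>+ \<omega>. ennreal ((norm (?Z \<omega>))\<^sup>2) \<partial>M) + ennreal (real m * (\<eta>\<^sup>2 * \<sigma>\<^sup>2))"
    using nn_integral_partial_round_le[OF subset_refl, of t]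
    by (simp only: partial_round_full partial_round_empty batches(3))
  then have "expected_sq_dist (Suc t) + ennreal ?\<gamma> * expected_gap t
      \<le> (\<integral>\<^sup>+ \<omega>. ennreal ((norm (?Z \<omega>))\<^sup>2) \<partial>M) + ennreal (real m * (\<eta>\<^sup>2 * \<sigma>\<^sup>2))
        + ennreal ?\<gamma> * expected_gap t"
    by (rule add_right_mono)
  also have "\<dots> = ((\<integral>\<^sup>+ \<omega>. ennreal ((norm (?Z \<omega>))\<^sup>2) \<partial>M) + ennreal ?\<gamma> * expected_gap t)
      + ennreal (real m * (\<eta>\<^sup>2 * \<sigma>\<^sup>2))"
    by (simp only: ac_simps)
  also have "\<dots> = (\<integral>\<^sup>+ \<omega>. ennreal ((norm (?Z \<omega>))\<^sup>2 + ?\<gamma> * (f (X t \<omega>) - f xs)) \<partial>M)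
      + ennreal (real m * (\<eta>\<^sup>2 * \<sigma>\<^sup>2))"
  proof -
    have "ennreal ((norm (?Z \<omega>))\<^sup>2 + ?\<gamma> * (f (X t \<omega>) - f xs))
        = ennreal ((norm (?Z \<omega>))\<^sup>2) + ennreal ?\<gamma> * ennreal (f (X t \<omega>) - f xs)" for \<omega>
      using step_size(1) minimum[of "X t \<omega>"] by (subst ennreal_plus) (auto simp: ennreal_mult)
    then show ?thesis
      by (simp add: nn_integral_add nn_integral_cmult)
  qed
  also have "\<dots> \<le> expected_sq_dist t + ennreal (real m * (\<eta>\<^sup>2 * \<sigma>\<^sup>2))"
    using step_size by (intro add_right_mono nn_integral_mono ennreal_leI gradient_step) auto
  finally show ?thesis .
qed

lemma sum_expected_gap_le:
  "expected_sq_dist R + ennreal (\<eta> * real m) * (\<Sum>t<R. expected_gap t)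
    \<le> ennreal ((norm (x0 - xs))\<^sup>2 + real R * (real m * (\<eta>\<^sup>2 * \<sigma>\<^sup>2)))"
proof (induction R)
  case 0
  show ?case
    by (simp add: emeasure_space_1)
next
  case (Suc R)
  let ?c = "ennreal (\<eta> * real m)" and ?v = "real m * (\<eta>\<^sup>2 * \<sigma>\<^sup>2)"
  have "expected_sq_dist (Suc R) + ?c * (\<Sum>t<Suc R. expected_gap t)
      = (expected_sq_dist (Suc R) + ?c * expected_gap R) + ?c * (\<Sum>t<R. expected_gap t)"
    by (simp only: sum.lessThan_Suc distrib_left ac_simps)
  also have "\<dots> \<le> (expected_sq_dist R + ennreal ?v) + ?c * (\<Sum>t<R. expected_gap t)"
    by (intro add_right_mono expected_sq_dist_step)
  also have "\<dots> = (expected_sq_dist R + ?c * (\<Sum>t<R. expected_gap t)) + ennreal ?v"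
    by (simp only: ac_simps)
  also have "\<dots> \<le> ennreal ((norm (x0 - xs))\<^sup>2 + real R * ?v) + ennreal ?v"
    by (intro add_right_mono Suc.IH)
  also have "\<dots> = ennreal ((norm (x0 - xs))\<^sup>2 + real (Suc R) * ?v)"
    by (subst ennreal_plus[symmetric]) (auto simp: algebra_simps)
  finally show ?case .
qed

end

text \<open>The last iterate gets weight zero: the telescoped estimate controls the gaps at the points
  where gradients were taken, \<open>X 0, \<dots>, X (R - 1)\<close>.\<close>
definition uniform_weights :: "nat \<Rightarrow> nat \<Rightarrow> real" where
  "uniform_weights R t = (if t < R then 1 / real R else 0)"

lemma sum_uniform_weights:
  fixes Y :: "nat \<Rightarrow> 'a::real_vector"
  shows "(\<Sum>t\<le>R. uniform_weights R t *\<^sub>R Y t) = (\<Sum>t<R. (1 / real R) *\<^sub>R Y t)"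
  unfolding lessThan_Suc_atMost[symmetric] by (simp add: uniform_weights_def)

lemma convex_uniform_weights: "1 \<le> R \<Longrightarrow> convex_weights R (uniform_weights R)"
  using sum_uniform_weights[of R "\<lambda>_. 1 :: real"]
  by (auto simp: convex_weights_def) (simp add: uniform_weights_def)

context batch_sgd_setting
begin

text \<open>Dividing the telescoped estimate by \<open>\<eta> * m * R\<close> splits the expected gap of the average into
  an initial-distance part and a noise part; each of the last two hypotheses makes one of them at
  most \<open>\<epsilon> / 2\<close>.\<close>
lemma eps_solution_uniform_average:
  assumes "1 \<le> R" and "0 \<le> \<epsilon>"
    and rounds: "(norm (x0 - xs))\<^sup>2 \<le> \<eta> * real m * real R * (\<epsilon> / 2)"
    and noise: "\<eta> * \<sigma>\<^sup>2 \<le> \<epsilon> / 2"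
  shows "eps_solution M f xs \<epsilon>
    (\<lambda>\<omega>. weighted_point R (uniform_weights R) (batch_sgd g x0 \<eta> J (\<lambda>k. \<xi> k \<omega>)))"
proof -
  let ?c = "\<eta> * real m"
  define Y where "Y \<omega> = (\<Sum>t<R. (1 / real R) *\<^sub>R X t \<omega>)" for \<omega>
  have [measurable]: "Y \<in> borel_measurable M"
    unfolding Y_def by measurable
  have c: "0 < ?c"
    using step_size by simp
  have jensen: "f (Y \<omega>) - f xs \<le> (\<Sum>t<R. 1 / real R * (f (X t \<omega>) - f xs))" for \<omega>
  proof -
    have "f (Y \<omega>) \<le> (\<Sum>t<R. 1 / real R * f (X t \<omega>))"
      unfolding Y_def using assms(1)
      by (intro convex_on_sum[OF _ _ convex]) (auto simp: lessThan_empty_iff)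
    moreover have "(\<Sum>t<R. 1 / real R * f xs) = f xs"
      using assms(1) by simp
    ultimately show ?thesis
      by (simp only: right_diff_distrib sum_subtractf)
  qed
  have "ennreal (?c * real R) * (\<integral>\<^sup>+ \<omega>. ennreal (f (Y \<omega>) - f xs) \<partial>M)
      \<le> ennreal (?c * real R) * (\<integral>\<^sup>+ \<omega>. (\<Sum>t<R. ennreal (1 / real R) * ennreal (f (X t \<omega>) - f xs)) \<partial>M)"
  proof (intro mult_left_mono nn_integral_mono)
    fix \<omega>
    show "ennreal (f (Y \<omega>) - f xs) \<le> (\<Sum>t<R. ennreal (1 / real R) * ennreal (f (X t \<omega>) - f xs))"
      using jensen[of \<omega>] minimum by (simp add: ennreal_mult[symmetric] sum_ennreal ennreal_leI)
  qed simp
  also have "\<dots> = ennreal (?c * real R) * (ennreal (1 / real R) * (\<Sum>t<R. expected_gap t))"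
    by (simp add: nn_integral_sum nn_integral_cmult sum_distrib_left)
  also have "\<dots> = ennreal ?c * (\<Sum>t<R. expected_gap t)"
    using assms(1) c by (simp add: mult.assoc[symmetric] ennreal_mult[symmetric])
  also have "\<dots> \<le> expected_sq_dist R + ennreal ?c * (\<Sum>t<R. expected_gap t)"
    by simp
  also have "\<dots> \<le> ennreal ((norm (x0 - xs))\<^sup>2 + real R * (real m * (\<eta>\<^sup>2 * \<sigma>\<^sup>2)))"
    by (rule sum_expected_gap_le)
  also have "\<dots> \<le> ennreal (?c * real R * \<epsilon>)"
  proof (rule ennreal_leI)
    have "real R * (real m * (\<eta>\<^sup>2 * \<sigma>\<^sup>2)) = ?c * real R * (\<eta> * \<sigma>\<^sup>2)"
      by (simp add: power2_eq_square)
    also have "\<dots> \<le> ?c * real R * (\<epsilon> / 2)"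
      using noise c by (intro mult_left_mono) auto
    finally show "(norm (x0 - xs))\<^sup>2 + real R * (real m * (\<eta>\<^sup>2 * \<sigma>\<^sup>2)) \<le> ?c * real R * \<epsilon>"
      using rounds by simp
  qed
  also have "\<dots> = ennreal (?c * real R) * ennreal \<epsilon>"
    using c assms by (intro ennreal_mult) auto
  finally have gap: "(\<integral>\<^sup>+ \<omega>. ennreal (f (Y \<omega>) - f xs) \<partial>M) \<le> ennreal \<epsilon>"
    using c assms(1) step_size(2) by (subst (asm) ennreal_mult_le_mult_iff) auto
  have integrable: "integrable M (\<lambda>\<omega>. f (Y \<omega>) - f xs)"
    using gap minimum by (intro integrableI_nonneg) (auto intro: le_less_trans)
  then have "ennreal (LINT \<omega>|M. f (Y \<omega>) - f xs) \<le> ennreal \<epsilon>"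
    using gap minimum by (subst (asm) nn_integral_eq_integral) auto
  then have "(LINT \<omega>|M. f (Y \<omega>) - f xs) \<le> \<epsilon>"
    using assms(2) by (simp add: ennreal_le_iff)
  moreover have f_integrable: "integrable M (\<lambda>\<omega>. f (Y \<omega>))"
    using Bochner_Integration.integrable_add[OF integrable integrable_const[of "f xs"]] by simp
  ultimately have "eps_solution M f xs \<epsilon> Y"
    by (simp add: eps_solution_def prob_space)
  then show ?thesis
    by (simp add: Y_def[abs_def] weighted_point_def sum_uniform_weights)
qed

end

section \<open>The two methods\<close>

lemma exists_nat_between:
  fixes a b :: real
  assumes "0 \<le> a" "a + 1 \<le> b"
  obtains r :: nat where "a \<le> real r" "real r \<le> b"
  using assms by (intro that[of "nat \<lceil>a\<rceil>"]) linarith+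

text \<open>Zero rounds suffice, as \<open>f x0 - f xs \<le> L / 2 * B\<^sup>2 \<le> \<epsilon>\<close>.\<close>
lemma (in smooth_convex_minimum) hero_finds_within_of_close:
  assumes "prob_space M" and "L * (norm (x0 - xs))\<^sup>2 / \<epsilon> \<le> 2" and "0 < \<epsilon>" and "0 \<le> T"
  shows "hero_finds_within M \<zeta> f g x0 xs \<epsilon> h T"
proof -
  interpret prob_space M by fact
  have "f x0 - f xs \<le> \<epsilon>"
    using suboptimality_le[of x0] assms(2,3) by (simp add: field_simps)
  then have "eps_solution M f xs \<epsilon>
      (\<lambda>\<omega>. weighted_point 0 (\<lambda>_. 1) (hero_sgd g x0 1 (\<lambda>k. \<zeta> k \<omega>)))"
    by (simp add: eps_solution_def weighted_point_def prob_space)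
  then show ?thesis
    using assms(4) unfolding hero_finds_within_def
    by (intro exI[of _ 1] exI[of _ 0] exI[of _ "\<lambda>_. 1"])
      (simp add: convex_weights_def hero_time_def)
qed

text \<open>Writing \<open>q = L * B\<^sup>2 / \<epsilon> + \<sigma>\<^sup>2 * B\<^sup>2 / \<epsilon>\<^sup>2\<close>, the required number of steps
  \<open>2 * B\<^sup>2 / (\<eta> * \<epsilon>)\<close> is exactly \<open>4 * q\<close>; the fifth \<open>q\<close> absorbs rounding up, which is where
  \<open>1 \<le> q\<close> enters.\<close>
lemma (in smooth_convex_minimum) hero_finds_within_of_far:
  assumes "stochastic_gradient D g grad \<sigma>" and "iid_samples M D \<zeta> UNIV"
    and "0 < \<epsilon>" "0 < h" and far: "1 \<le> L * (norm (x0 - xs))\<^sup>2 / \<epsilon>"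
  shows "hero_finds_within M \<zeta> f g x0 xs \<epsilon> h
    (5 * (h * (L * (norm (x0 - xs))\<^sup>2 / \<epsilon> + \<sigma>\<^sup>2 * (norm (x0 - xs))\<^sup>2 / \<epsilon>\<^sup>2)))"
proof -
  let ?B = "norm (x0 - xs)"
  define q where "q = L * ?B\<^sup>2 / \<epsilon> + \<sigma>\<^sup>2 * ?B\<^sup>2 / \<epsilon>\<^sup>2"
  define \<Lambda> where "\<Lambda> = L + \<sigma>\<^sup>2 / \<epsilon>"
  \<comment> \<open>Up to a factor of two this is the smaller of \<open>1 / (2 * L)\<close>, the largest step allowed by
    smoothness, and \<open>\<epsilon> / (2 * \<sigma>\<^sup>2)\<close>, the largest one that keeps the noise below \<open>\<epsilon> / 2\<close>.\<close>
  define \<eta> where "\<eta> = 1 / (2 * \<Lambda>)"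
  have "0 \<le> \<sigma>\<^sup>2 * ?B\<^sup>2 / \<epsilon>\<^sup>2"
    by simp
  then have "1 \<le> q"
    using far unfolding q_def by linarith
  then obtain R :: nat where R: "4 * q \<le> real R" "real R \<le> 5 * q"
    using exists_nat_between[of "4 * q" "5 * q"] by auto
  have denom: "0 < \<Lambda>"
    using L_pos assms(3) unfolding \<Lambda>_def by (intro add_pos_nonneg) auto
  then have "0 < \<eta>"
    by (simp add: \<eta>_def)
  have "1 \<le> R"
    using R \<open>1 \<le> q\<close> by linarith
  interpret batch_sgd_setting f grad L xs D g \<sigma> M \<zeta> UNIV "\<lambda>t. {t}" 1 x0 \<eta>
    using assms \<open>0 < \<eta>\<close> denom
    by unfold_locales (auto simp: disjoint_family_on_def \<eta>_def \<Lambda>_def field_simps)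
  have "eps_solution M f xs \<epsilon>
      (\<lambda>\<omega>. weighted_point R (uniform_weights R) (hero_sgd g x0 \<eta> (\<lambda>k. \<zeta> k \<omega>)))"
    unfolding hero_sgd_eq_batch_sgd
  proof (rule eps_solution_uniform_average)
    have "q = (\<Lambda>) * ?B\<^sup>2 / \<epsilon>"
      using assms(3) by (simp add: q_def \<Lambda>_def field_simps power2_eq_square)
    then have "?B\<^sup>2 = q * \<epsilon> / (\<Lambda>)"
      using denom assms(3) by (simp add: nonzero_eq_divide_eq)
    also have "\<dots> = \<eta> * (4 * q) * (\<epsilon> / 2)"
      by (simp add: \<eta>_def)
    also have "\<dots> \<le> \<eta> * real R * (\<epsilon> / 2)"
      using R \<open>0 < \<eta>\<close> assms(3) by (intro mult_right_mono mult_left_mono) auto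
    finally show "?B\<^sup>2 \<le> \<eta> * real 1 * real R * (\<epsilon> / 2)"
      by simp
    have "\<sigma>\<^sup>2 / \<epsilon> \<le> \<Lambda>"
      using L_pos by (simp add: \<Lambda>_def)
    then show "\<eta> * \<sigma>\<^sup>2 \<le> \<epsilon> / 2"
      using denom assms(3) by (simp add: \<eta>_def field_simps)
  qed (use \<open>1 \<le> R\<close> assms in auto)
  moreover have "hero_time h R \<le> 5 * (h * q)"
    using R assms(4) by (simp add: hero_time_def)
  ultimately show ?thesis
    using \<open>0 < \<eta>\<close> \<open>1 \<le> R\<close> unfolding hero_finds_within_def q_def[symmetric]
    by (blast intro: convex_uniform_weights)
qed

text \<open>The step size per sample is chosen so that a whole round has length \<open>1 / (2 * L)\<close>, hence the
  number of rounds is that of the noiseless method. The batch size per worker then only has to beat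
  \<open>p = \<sigma>\<^sup>2 / (L * n * \<epsilon>)\<close>, and \<open>p * (L * B\<^sup>2 / \<epsilon>)\<close> is exactly the variance term of the bound. As
  \<open>p\<close> may be arbitrarily small, rounding it up to a positive integer costs the summand \<open>1\<close> in
  \<open>K \<le> 1 + p\<close>, which gives rise to the term \<open>h * (L * B\<^sup>2 / \<epsilon>)\<close>.\<close>
lemma (in smooth_convex_minimum) minibatch_finds_within_of_far:
  assumes "stochastic_gradient D g grad \<sigma>" and "iid_samples M D \<xi> (UNIV \<times> {..<n} \<times> UNIV)"
    and "0 < \<epsilon>" "0 < h" "0 < \<tau>" "1 \<le> n" and far: "1 \<le> L * (norm (x0 - xs))\<^sup>2 / \<epsilon>"
  shows "minibatch_finds_within M \<xi> f g x0 xs n \<epsilon> h \<tau>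
    (5 * (\<tau> * (L * (norm (x0 - xs))\<^sup>2 / \<epsilon>)
        + h * (L * (norm (x0 - xs))\<^sup>2 / \<epsilon> + \<sigma>\<^sup>2 * (norm (x0 - xs))\<^sup>2 / (real n * \<epsilon>\<^sup>2))))"
proof -
  let ?B = "norm (x0 - xs)"
  define q where "q = L * ?B\<^sup>2 / \<epsilon>"
  define p where "p = \<sigma>\<^sup>2 / (L * real n * \<epsilon>)"
  have "0 \<le> p"
    using L_pos assms(3) by (simp add: p_def)
  have "1 \<le> q"
    using far by (simp add: q_def)
  obtain R :: nat where R: "4 * q \<le> real R" "real R \<le> 5 * q"
    using exists_nat_between[of "4 * q" "5 * q"] \<open>1 \<le> q\<close> by auto
  define K where "K = Suc (nat \<lfloor>p\<rfloor>)"
  have K: "p \<le> real K" "real K \<le> 1 + p" "1 \<le> K"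
    unfolding K_def using \<open>0 \<le> p\<close> by linarith+
  define \<eta> where "\<eta> = 1 / (2 * L * real (n * K))"
  have nK: "0 < real (n * K)"
    using assms(6) K(3) by simp
  have "0 < \<eta>" and total: "\<eta> * real (n * K) = 1 / (2 * L)"
    using L_pos assms(6) K(3) by (auto simp: \<eta>_def)
  have "1 \<le> R"
    using R \<open>1 \<le> q\<close> by linarith
  interpret batch_sgd_setting f grad L xs D g \<sigma> M \<xi> "UNIV \<times> {..<n} \<times> UNIV"
      "\<lambda>t. Pair t ` ({..<n} \<times> {..<K})" "n * K" x0 \<eta>
  proof unfold_locales
    show "card (Pair t ` ({..<n} \<times> {..<K})) = n * K" for t :: nat
      by (simp add: card_image inj_on_def)
    show "1 \<le> n * K"
      using assms(6) K(3) by simp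
    show "\<eta> * real (n * K) * (2 * L) \<le> 1"
      unfolding total using L_pos by simp
  qed (use assms \<open>0 < \<eta>\<close> in \<open>auto simp: disjoint_family_on_def\<close>)
  have "eps_solution M f xs \<epsilon>
      (\<lambda>\<omega>. weighted_point R (uniform_weights R) (minibatch_sgd g x0 n \<eta> K (\<lambda>k. \<xi> k \<omega>)))"
    unfolding minibatch_sgd_eq_batch_sgd
  proof (rule eps_solution_uniform_average)
    have "?B\<^sup>2 = 1 / (2 * L) * (4 * q) * (\<epsilon> / 2)"
      using L_pos assms(3) by (simp add: q_def)
    also have "\<dots> \<le> 1 / (2 * L) * real R * (\<epsilon> / 2)"
      using R L_pos assms(3) by (intro mult_right_mono mult_left_mono) auto
    finally show "?B\<^sup>2 \<le> \<eta> * real (n * K) * real R * (\<epsilon> / 2)"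
      by (simp only: total)
    have "\<sigma>\<^sup>2 = p * (L * real n * \<epsilon>)"
      using L_pos assms(3,6) by (simp add: p_def)
    also have "\<dots> \<le> real K * (L * real n * \<epsilon>)"
      using K L_pos assms(3) by (intro mult_right_mono) auto
    finally show "\<eta> * \<sigma>\<^sup>2 \<le> \<epsilon> / 2"
      using nK L_pos by (simp add: \<eta>_def field_simps)
  qed (use \<open>1 \<le> R\<close> assms in auto)
  moreover have "minibatch_time h \<tau> K R \<le> 5 * (\<tau> * q + h * (q + \<sigma>\<^sup>2 * ?B\<^sup>2 / (real n * \<epsilon>\<^sup>2)))"
  proof -
    have "real K * real R \<le> (1 + p) * (5 * q)"
      using K R \<open>0 \<le> p\<close> by (intro mult_mono) auto
    also have "\<dots> = 5 * (q + p * q)"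
      by (simp add: algebra_simps)
    also have "p * q = \<sigma>\<^sup>2 * ?B\<^sup>2 / (real n * \<epsilon>\<^sup>2)"
      using L_pos by (simp add: p_def q_def power2_eq_square)
    finally have "h * (real K * real R) \<le> h * (5 * (q + \<sigma>\<^sup>2 * ?B\<^sup>2 / (real n * \<epsilon>\<^sup>2)))"
      using assms(4) by (intro mult_left_mono) auto
    moreover have "\<tau> * real R \<le> \<tau> * (5 * q)"
      using R assms(5) by (intro mult_left_mono) auto
    ultimately show ?thesis
      by (simp add: minibatch_time_def algebra_simps)
  qed
  ultimately show ?thesis
    using \<open>0 < \<eta>\<close> \<open>1 \<le> R\<close> K(3) unfolding minibatch_finds_within_def q_def[symmetric]
    by (blast intro: convex_uniform_weights)
qed

lemma hero_finds_within_mono: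
  "hero_finds_within M \<zeta> f g x0 xs \<epsilon> h T \<Longrightarrow> T \<le> T' \<Longrightarrow> hero_finds_within M \<zeta> f g x0 xs \<epsilon> h T'"
  unfolding hero_finds_within_def by (meson order_trans)

lemma minibatch_finds_within_mono:
  "minibatch_finds_within M \<xi> f g x0 xs n \<epsilon> h \<tau> T \<Longrightarrow> T \<le> T' \<Longrightarrow>
    minibatch_finds_within M \<xi> f g x0 xs n \<epsilon> h \<tau> T'"
  unfolding minibatch_finds_within_def by (meson order_trans)

lemma closed_minimizers:
  fixes f :: "'a::euclidean_space \<Rightarrow> real"
  assumes "continuous_on UNIV f"
  shows "closed (minimizers f)"
proof -
  have "minimizers f = (\<Inter>y. {x. f x \<le> f y})"
    by (auto simp: minimizers_def)
  then show ?thesis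
    using assms by (auto intro!: closed_Collect_le continuous_on_const)
qed

theorem theorem2p2:
  fixes f :: "'a::euclidean_space \<Rightarrow> real"
    and grad :: "'a \<Rightarrow> 'a"
    and g :: "'a \<Rightarrow> 's \<Rightarrow> 'a"
    and D :: "'s measure"
    and M :: "'w measure"
    and \<xi> :: "nat \<times> nat \<times> nat \<Rightarrow> 'w \<Rightarrow> 's"
    and M' :: "'v measure"
    and \<zeta> :: "nat \<Rightarrow> 'v \<Rightarrow> 's"
    and x0 xs :: 'a
    and L \<epsilon> h \<tau> \<sigma> B :: real
    and n :: nat
  assumes "0 < L" "0 < \<epsilon>" "0 < h" "0 < \<tau>" "0 \<le> \<sigma>" "1 \<le> n"
    and gradient: "\<forall>x. GDERIV f x :> grad x"
    and smooth: "\<forall>x y. norm (grad x - grad y) \<le> L * norm (x - y)"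
    and convex: "convex_on UNIV f"
    and attained: "minimizers f \<noteq> {}"
    and xs: "xs = closest_point (minimizers f) x0"
    and B: "B = norm (x0 - xs)"
    and stochastic: "stochastic_gradient D g grad \<sigma>"
    and minibatch_samples: "iid_samples M D \<xi> (UNIV \<times> {..<n} \<times> UNIV)"
    and hero_samples: "iid_samples M' D \<zeta> UNIV"
  shows "0 < universal_constant \<and>
    (let T = universal_constant *
           min (\<tau> * (L * B\<^sup>2 / \<epsilon>) + h * (L * B\<^sup>2 / \<epsilon> + \<sigma>\<^sup>2 * B\<^sup>2 / (real n * \<epsilon>\<^sup>2)))
               (h * (L * B\<^sup>2 / \<epsilon> + \<sigma>\<^sup>2 * B\<^sup>2 / \<epsilon>\<^sup>2))
     in minibatch_finds_within M \<xi> f g x0 xs n \<epsilon> h \<tau> T \<or>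
        hero_finds_within M' \<zeta> f g x0 xs \<epsilon> h T)"
proof -
  have "continuous_on UNIV f"
    using gradient by (intro continuous_on_GDERIV) blast
  then have "xs \<in> minimizers f"
    unfolding xs using attained by (intro closest_point_in_set closed_minimizers)
  then interpret smooth_convex_minimum f grad L xs
    using assms by unfold_locales (auto simp: minimizers_def)
  have scale: "5 * T \<le> universal_constant * T" if "0 \<le> T" for T
    using that by (simp add: universal_constant_def)
  let ?Tm = "\<tau> * (L * B\<^sup>2 / \<epsilon>) + h * (L * B\<^sup>2 / \<epsilon> + \<sigma>\<^sup>2 * B\<^sup>2 / (real n * \<epsilon>\<^sup>2))"
  let ?Th = "h * (L * B\<^sup>2 / \<epsilon> + \<sigma>\<^sup>2 * B\<^sup>2 / \<epsilon>\<^sup>2)"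
  have nonneg: "0 \<le> ?Tm" "0 \<le> ?Th"
    using \<open>0 < L\<close> \<open>0 < \<epsilon>\<close> \<open>0 < h\<close> \<open>0 < \<tau>\<close> by simp_all
  have "minibatch_finds_within M \<xi> f g x0 xs n \<epsilon> h \<tau> (universal_constant * min ?Tm ?Th) \<or>
      hero_finds_within M' \<zeta> f g x0 xs \<epsilon> h (universal_constant * min ?Tm ?Th)"
  proof (cases "L * B\<^sup>2 / \<epsilon> \<le> 2")
    case True
    have "prob_space M'"
      using hero_samples by (simp add: iid_samples_def)
    then show ?thesis
      using True nonneg \<open>0 < \<epsilon>\<close> unfolding B
      by (intro disjI2 hero_finds_within_of_close) (auto simp: universal_constant_def)
  next
    case False
    then have far: "1 \<le> L * (norm (x0 - xs))\<^sup>2 / \<epsilon>"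
      unfolding B by linarith
    show ?thesis
    proof (cases "?Tm \<le> ?Th")
      case True
      have "minibatch_finds_within M \<xi> f g x0 xs n \<epsilon> h \<tau> (5 * ?Tm)"
        unfolding B using assms far
        by (intro minibatch_finds_within_of_far[OF stochastic minibatch_samples]) auto
      moreover have "5 * ?Tm \<le> universal_constant * min ?Tm ?Th"
        unfolding min_absorb1[OF True] by (rule scale[OF nonneg(1)])
      ultimately show ?thesis
        by (blast intro: minibatch_finds_within_mono)
    next
      case False
      have "hero_finds_within M' \<zeta> f g x0 xs \<epsilon> h (5 * ?Th)"
        unfolding B using assms far
        by (intro hero_finds_within_of_far[OF stochastic hero_samples]) auto
      moreover have "5 * ?Th \<le> universal_constant * min ?Tm ?Th"
        using scale[OF nonneg(2)] False by (simp only: min_absorb2 linear not_le less_imp_le)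
      ultimately show ?thesis
        by (blast intro: hero_finds_within_mono)
    qed
  qed
  then show ?thesis
    by (simp add: Let_def universal_constant_def)
qed

end
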